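(* Let $f$ and $g$ be two integrable functions on $[0,\infty)$ and let $m,M,p,P\in\mathbb{R}$ be such that $$m\le f(x)\le M,\qquad p\le g(x)\le P\qquad\text{for all } x\in[0,\infty).$$ Let $\beta,\kappa\in\mathbb{R}$, $x>0$, $\alpha>0$, $\gamma>0$, $\rho>0$ and $\eta\ge 0$. Write $\Lambda_\alpha=\Lambda_{x,\kappa}^{\rho,\beta}(\alpha,\eta)$, $\Lambda_\gamma=\Lambda_{x,\kappa}^{\rho,\beta}(\gamma,\eta)$, $I^\alpha\varphi={}^{\rho}\mathcal{I}_{\eta,\kappa}^{\alpha,\beta}\varphi(x)$ and $I^\gamma\varphi={}^{\rho}\mathcal{I}_{\eta,\kappa}^{\gamma,\beta}\varphi(x)$. Then $$\begin{aligned} &\bigl(\Lambda_\alpha\,I^\gamma(fg)+\Lambda_\gamma\,I^\alpha(fg)-I^\alpha f\,I^\gamma g-I^\gamma f\,I^\alpha g\bigr)^2\\ &\le\bigl[(M\Lambda_\alpha-I^\alpha f)(I^\gamma f-m\Lambda_\gamma)+(I^\alpha f-m\Lambda_\alpha)(M\Lambda_\gamma-I^\gamma f)\bigr]\\ &\quad\times\bigl[(P\Lambda_\alpha-I^\alpha g)(I^\gamma g-p\Lambda_\gamma)+(I^\alpha g-p\Lambda_\alpha)(P\Lambda_\gamma-I^\gamma g)\bigr]. \end{aligned}$$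
   Context: For a function $\varphi$ on $[0,\infty)$ and $\alpha>0$, the (left-sided, based at $0$) Katugampola fractional integral is $${}^{\rho}\mathcal{I}_{\eta,\kappa}^{\alpha,\beta}\varphi(x)=\frac{\rho^{1-\beta}x^{\kappa}}{\Gamma(\alpha)}\int_{0}^{x}\frac{\tau^{\rho(\eta+1)-1}}{(x^{\rho}-\tau^{\rho})^{1-\alpha}}\varphi(\tau)\,d\tau,\qquad x>0,$$ whenever the integral exists; the operator with $\gamma$ is obtained by replacing $\alpha$ by $\gamma$. Moreover $$\Lambda_{x,\kappa}^{\rho,\beta}(\alpha,\eta)=\frac{\Gamma(\eta+1)}{\Gamma(\eta+\alpha+1)}\rho^{-\beta}x^{\kappa+\rho(\eta+\alpha)},$$ and similarly with $\gamma$ in place of $\alpha$. Here $fg$ denotes the pointwise product. *)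

theory Defs
  imports "HOL-Analysis.Analysis"
begin

text \<open>
  The left-sided Katugampola fractional integral based at 0. All real powers are \<^const>\<open>powr\<close>;
  its conventional value 0 at base 0, and the resulting value of the integrand, matter only at the
  endpoints \<open>\<tau> = 0\<close> and \<open>\<tau> = x\<close>, a null set. The integral is a Lebesgue integral,
  so the value is meaningful only where the integrand is integrable (for \<open>x, \<alpha>, \<rho> > 0\<close> and
  \<open>\<eta> \<ge> 0\<close> the weight is integrable on \<open>[0,x]\<close>, hence the integral exists whenever
  \<open>\<phi>\<close> is bounded and measurable there).
\<close>
definition katugampola_integral ::
  "real \<Rightarrow> real \<Rightarrow> real \<Rightarrow> real \<Rightarrow> real \<Rightarrow> (real \<Rightarrow> real) \<Rightarrow> real \<Rightarrow> real" where
  "katugampola_integral \<rho> \<eta> \<kappa> \<alpha> \<beta> \<phi> x =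
     \<rho> powr (1 - \<beta>) * x powr \<kappa> / Gamma \<alpha> *
     (LINT \<tau>:{0..x}|lebesgue.
        \<tau> powr (\<rho> * (\<eta> + 1) - 1) / (x powr \<rho> - \<tau> powr \<rho>) powr (1 - \<alpha>) * \<phi> \<tau>)"

definition katugampola_Lambda :: "real \<Rightarrow> real \<Rightarrow> real \<Rightarrow> real \<Rightarrow> real \<Rightarrow> real \<Rightarrow> real" where
  "katugampola_Lambda \<rho> \<beta> x \<kappa> \<alpha> \<eta> =
     Gamma (\<eta> + 1) / Gamma (\<eta> + \<alpha> + 1) * \<rho> powr (- \<beta>) * x powr (\<kappa> + \<rho> * (\<eta> + \<alpha>))"

text \<open>
  Integrability on \<open>[0,\<infty>)\<close> in the sense of Lebesgue integrability on every \<open>[0,T]\<close>. This is implied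
  by integrability over the whole half-line, but also admits functions bounded below by a
  positive constant, such as the constant 1.
\<close>
definition integrable_on_halfline :: "(real \<Rightarrow> real) \<Rightarrow> bool" where
  "integrable_on_halfline f \<longleftrightarrow> (\<forall>T\<ge>0. f absolutely_integrable_on {0..T})"

end

theory Submission
  imports Defs
begin

text \<open>
  The expression being squared is \<open>H f g\<close> for the symmetric bilinear form
  \<open>H \<phi> \<psi> = \<Lambda>\<^sub>\<alpha> I\<^sup>\<gamma>(\<phi> \<psi>) + \<Lambda>\<^sub>\<gamma> I\<^sup>\<alpha>(\<phi> \<psi>) - I\<^sup>\<alpha> \<phi> I\<^sup>\<gamma> \<psi> - I\<^sup>\<gamma> \<phi> I\<^sup>\<alpha> \<psi>\<close>.
  Both operators are positive functionals with \<open>I\<^sup>\<alpha> 1 = \<Lambda>\<^sub>\<alpha>\<close> (a Beta integral, by the substitution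
  \<open>u = (\<tau>/x)\<^sup>\<rho>\<close>), so \<open>H\<close> is positive semidefinite and Cauchy--Schwarz gives
  \<open>(H f g)\<^sup>2 \<le> H f f H g g\<close>. Each diagonal term is bounded by the corresponding factor on the right,
  the difference being \<open>\<Lambda>\<^sub>\<alpha> I\<^sup>\<gamma> q + \<Lambda>\<^sub>\<gamma> I\<^sup>\<alpha> q \<ge> 0\<close> with \<open>q = (M - f) (f - m)\<close>, and likewise for \<open>g\<close>.
\<close>

text \<open>Pulling the Beta integrand back along \<open>h\<close> and multiplying by the Jacobian
  \<open>h'\<close> gives the weight up to a constant factor; the hypotheses make both Beta
  parameters \<open>\<eta> + 1\<close> and \<open>\<alpha>\<close> positive.\<close>

lemma katugampola_weight_has_integral:
  fixes \<rho> \<eta> \<alpha> x :: real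
  defines "w \<equiv> \<lambda>\<tau>. \<tau> powr (\<rho> * (\<eta> + 1) - 1) / (x powr \<rho> - \<tau> powr \<rho>) powr (1 - \<alpha>)"
  assumes x: "x > 0" and \<alpha>: "\<alpha> > 0" and \<rho>: "\<rho> > 0" and \<eta>: "\<eta> > -1"
  shows "(w has_integral x powr (\<rho> * (\<eta> + \<alpha>)) / \<rho> * Beta (\<eta> + 1) \<alpha>) {0..x}"
proof -
  define B :: "real \<Rightarrow> real" where "B = (\<lambda>u. u powr (\<eta> + 1 - 1) * (1 - u) powr (\<alpha> - 1))"
  define h where "h = (\<lambda>\<tau>. (\<tau> / x) powr \<rho>)"
  define h' where "h' = (\<lambda>\<tau>. \<rho> * \<tau> powr (\<rho> - 1) / x powr \<rho>)"
  \<comment> \<open>The open interval avoids \<open>\<tau> = 0\<close>, where \<open>h\<close> is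
    not differentiable if \<open>\<rho> < 1\<close>; the endpoints are restored at the end.\<close>
  have "(B has_integral Beta (\<eta> + 1) \<alpha>) {0<..<1}"
    unfolding B_def using has_integral_Beta_real[of "\<eta> + 1" \<alpha>] \<alpha> \<eta>
    by (simp add: has_integral_Icc_iff_Ioo)
  moreover have "B absolutely_integrable_on {0<..<1}"
    using has_integral_integrable[OF calculation]
    by (rule nonnegative_absolutely_integrable_1) (simp add: B_def)
  moreover have image: "h ` {0<..<x} = {0<..<1}"
  proof (intro set_eqI iffI)
    fix u assume "u \<in> h ` {0<..<x}"
    then show "u \<in> {0<..<1}"
      using x \<rho> by (auto simp: h_def powr01_less_one)
  next
    fix u :: real assume u: "u \<in> {0<..<1}"
    then have "u powr (1 / \<rho>) < 1" using \<rho> by (simp add: powr01_less_one)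
    then have "x * u powr (1 / \<rho>) \<in> {0<..<x}" "h (x * u powr (1 / \<rho>)) = u"
      using u x \<rho> by (auto simp: h_def powr_powr)
    then show "u \<in> h ` {0<..<x}" by (metis imageI)
  qed
  moreover have "inj_on h {0<..<x}"
    by (rule inj_on_inverseI[where g = "\<lambda>u. x * u powr (1 / \<rho>)"])
      (use x \<rho> in \<open>auto simp: h_def powr_powr\<close>)
  moreover have "(h has_field_derivative h' \<tau>) (at \<tau> within {0<..<x})" if "\<tau> \<in> {0<..<x}" for \<tau>
    using that x \<rho> unfolding h_def h'_def
    by (auto intro!: derivative_eq_intros simp: powr_divide powr_diff field_simps)
  ultimately have abs: "(\<lambda>\<tau>. \<bar>h' \<tau>\<bar> * B (h \<tau>)) absolutely_integrable_on {0<..<x}"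
    and "integral {0<..<x} (\<lambda>\<tau>. \<bar>h' \<tau>\<bar> * B (h \<tau>)) = Beta (\<eta> + 1) \<alpha>"
    using has_absolute_integral_change_of_variables_1'[of "{0<..<x}" h h' B "Beta (\<eta> + 1) \<alpha>"]
    by (auto simp: has_integral_iff)
  then have "((\<lambda>\<tau>. \<bar>h' \<tau>\<bar> * B (h \<tau>)) has_integral Beta (\<eta> + 1) \<alpha>) {0<..<x}"
    using set_lebesgue_integral_eq_integral(1) has_integral_iff by blast
  \<comment> \<open>The constant undoes the scaling by \<open>x\<close>: \<open>h'\<close>
    contributes the exponent \<open>\<rho>\<close>, the two Beta factors contribute
    \<open>\<rho> * \<eta>\<close> and \<open>\<rho> * (\<alpha> - 1)\<close>, and
    \<open>1 / \<rho>\<close> cancels the factor in \<open>h'\<close>.\<close>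
  then have "((\<lambda>\<tau>. x powr (\<rho> * (\<eta> + \<alpha>)) / \<rho> * (\<bar>h' \<tau>\<bar> * B (h \<tau>)))
      has_integral x powr (\<rho> * (\<eta> + \<alpha>)) / \<rho> * Beta (\<eta> + 1) \<alpha>) {0<..<x}"
    by (rule has_integral_mult_right)
  moreover have "x powr (\<rho> * (\<eta> + \<alpha>)) / \<rho> * (\<bar>h' \<tau>\<bar> * B (h \<tau>)) = w \<tau>" if "\<tau> \<in> {0<..<x}" for \<tau>
  proof -
    have lt: "\<tau> powr \<rho> < x powr \<rho>" using that \<rho> by (auto intro: powr_less_mono2)
    have "1 - h \<tau> = (x powr \<rho> - \<tau> powr \<rho>) / x powr \<rho>"
      using that x by (simp add: h_def powr_divide field_simps)
    then have "(1 - h \<tau>) powr (\<alpha> - 1) = (x powr \<rho> - \<tau> powr \<rho>) powr (\<alpha> - 1) / x powr (\<rho> * (\<alpha> - 1))"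
      using lt by (simp add: powr_divide powr_powr)
    then have "x powr (\<rho> * (\<eta> + \<alpha>)) / \<rho> * (\<bar>h' \<tau>\<bar> * B (h \<tau>))
      = (x powr (\<rho> * (\<eta> + \<alpha>)) / (x powr \<rho> * x powr (\<rho> * \<eta>) * x powr (\<rho> * (\<alpha> - 1))))
        * (\<tau> powr (\<rho> - 1) * \<tau> powr (\<rho> * \<eta>)) * (x powr \<rho> - \<tau> powr \<rho>) powr (\<alpha> - 1)"
      using that x \<rho> by (simp add: B_def h_def h'_def powr_divide powr_powr)
    also have "x powr \<rho> * x powr (\<rho> * \<eta>) * x powr (\<rho> * (\<alpha> - 1)) = x powr (\<rho> * (\<eta> + \<alpha>))"
      by (simp add: powr_add [symmetric] algebra_simps)
    also have "\<tau> powr (\<rho> - 1) * \<tau> powr (\<rho> * \<eta>) = \<tau> powr (\<rho> * (\<eta> + 1) - 1)"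
      by (simp add: powr_add [symmetric] algebra_simps)
    also have "(x powr \<rho> - \<tau> powr \<rho>) powr (\<alpha> - 1) = 1 / (x powr \<rho> - \<tau> powr \<rho>) powr (1 - \<alpha>)"
      by (metis minus_diff_eq powr_minus_divide)
    finally show ?thesis using x by (simp add: w_def)
  qed
  ultimately have "(w has_integral x powr (\<rho> * (\<eta> + \<alpha>)) / \<rho> * Beta (\<eta> + 1) \<alpha>) {0<..<x}"
    by (metis (no_types, lifting) has_integral_cong)
  then show ?thesis by (simp add: has_integral_Icc_iff_Ioo)
qed

lemma katugampola_weight_integrable:
  fixes \<rho> \<eta> \<alpha> x :: real
  assumes "x > 0" and "\<alpha> > 0" and "\<rho> > 0" and "\<eta> > -1"
  shows "(\<lambda>\<tau>. \<tau> powr (\<rho> * (\<eta> + 1) - 1) / (x powr \<rho> - \<tau> powr \<rho>) powr (1 - \<alpha>))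
    absolutely_integrable_on {0..x}"
  using has_integral_integrable[OF katugampola_weight_has_integral[OF assms]]
  by (rule nonnegative_absolutely_integrable_1) simp

text \<open>In the Gamma quotient for \<open>Beta (\<eta> + 1) \<alpha>\<close> the factor
  \<open>Gamma \<alpha>\<close> cancels the normalisation, and \<open>1 / \<rho>\<close> turns
  \<open>\<rho> powr (1 - \<beta>)\<close> into \<open>\<rho> powr (- \<beta>)\<close>.\<close>

lemma katugampola_integral_one:
  assumes "x > 0" and "\<alpha> > 0" and "\<rho> > 0" and "\<eta> > -1"
  shows "katugampola_integral \<rho> \<eta> \<kappa> \<alpha> \<beta> (\<lambda>_. 1) x = katugampola_Lambda \<rho> \<beta> x \<kappa> \<alpha> \<eta>"
proof -
  have "(LINT \<tau>:{0..x}|lebesgue. \<tau> powr (\<rho> * (\<eta> + 1) - 1) / (x powr \<rho> - \<tau> powr \<rho>) powr (1 - \<alpha>) * 1)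
      = x powr (\<rho> * (\<eta> + \<alpha>)) / \<rho> * Beta (\<eta> + 1) \<alpha>"
    using katugampola_weight_has_integral[OF assms] katugampola_weight_integrable[OF assms]
    by (simp add: set_lebesgue_integral_eq_integral(2) integral_unique)
  moreover have "\<rho> powr (1 - \<beta>) = \<rho> * \<rho> powr (- \<beta>)"
    using assms by (simp add: powr_diff powr_minus field_simps)
  moreover have "Gamma \<alpha> \<noteq> 0" using Gamma_real_pos[of \<alpha>] assms by linarith
  ultimately show ?thesis
    using assms unfolding katugampola_integral_def katugampola_Lambda_def
    by (simp add: Beta_def powr_add add_ac)
qed

lemma katugampola_Lambda_pos:
  assumes "x > 0" and "\<alpha> > 0" and "\<rho> > 0" and "\<eta> > -1"
  shows "katugampola_Lambda \<rho> \<beta> x \<kappa> \<alpha> \<eta> > 0"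
  using assms unfolding katugampola_Lambda_def
  by (auto intro!: mult_pos_pos divide_pos_pos Gamma_real_pos)

text \<open>Linearity and positivity of the operator in one statement. The free coefficients cover
  both the squares \<open>(s * f + t * g - c)\<^sup>2\<close> and the products
  \<open>(M - f) * (f - m)\<close>, \<open>(P - g) * (g - p)\<close>.\<close>

lemma katugampola_integral_quadratic_nonneg:
  fixes f g :: "real \<Rightarrow> real" and \<rho> \<eta> \<kappa> \<alpha> \<beta> x :: real
  assumes pos: "x > 0" "\<alpha> > 0" "\<rho> > 0" "\<eta> > -1"
    and f: "f absolutely_integrable_on {0..x}" "bounded (f ` {0..x})"
    and g: "g absolutely_integrable_on {0..x}" "bounded (g ` {0..x})"
    and nonneg: "\<And>t. t \<in> {0..x} \<Longrightarrow>
      0 \<le> a * (f t * f t) + b * (f t * g t) + c * (g t * g t) + d * f t + e * g t + k"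
  defines "I \<equiv> \<lambda>\<phi>. katugampola_integral \<rho> \<eta> \<kappa> \<alpha> \<beta> \<phi> x"
  shows "0 \<le> a * I (\<lambda>t. f t * f t) + b * I (\<lambda>t. f t * g t) + c * I (\<lambda>t. g t * g t)
    + d * I f + e * I g + k * katugampola_Lambda \<rho> \<beta> x \<kappa> \<alpha> \<eta>"
proof -
  define w where "w = (\<lambda>\<tau>. \<tau> powr (\<rho> * (\<eta> + 1) - 1) / (x powr \<rho> - \<tau> powr \<rho>) powr (1 - \<alpha>))"
  define C where "C = \<rho> powr (1 - \<beta>) * x powr \<kappa> / Gamma \<alpha>"
  have I: "I \<phi> = C * (LINT \<tau>:{0..x}|lebesgue. w \<tau> * \<phi> \<tau>)" for \<phi>
    by (simp add: I_def katugampola_integral_def C_def w_def)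
  have w: "w absolutely_integrable_on {0..x}"
    unfolding w_def by (rule katugampola_weight_integrable[OF pos])
  \<comment> \<open>The weight may be unbounded, so bounded measurable factors are attached one at a
    time to an integrable function: first to \<open>w\<close> itself, then to \<open>w * f\<close>
    and \<open>w * g\<close>.\<close>
  have times_w: "(\<lambda>t. w t * (\<phi> t * \<psi> t)) absolutely_integrable_on {0..x}"
    if \<phi>: "\<phi> absolutely_integrable_on {0..x}" "bounded (\<phi> ` {0..x})"
      and \<psi>: "(\<lambda>t. w t * \<psi> t) absolutely_integrable_on {0..x}" for \<phi> \<psi>
  proof -
    have "(\<lambda>t. \<phi> t * (w t * \<psi> t)) absolutely_integrable_on {0..x}"
      by (rule absolutely_integrable_bounded_measurable_product_real[OF _ _ \<phi>(2) \<psi>])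
        (use \<phi>(1) in \<open>simp_all add: absolutely_integrable_measurable\<close>)
    then show ?thesis by (simp add: mult_ac)
  qed
  have 1: "(\<lambda>t. w t * 1) absolutely_integrable_on {0..x}" using w by simp
  have wf: "(\<lambda>t. w t * f t) absolutely_integrable_on {0..x}"
    and wg: "(\<lambda>t. w t * g t) absolutely_integrable_on {0..x}"
    using times_w[OF f 1] times_w[OF g 1] by simp_all
  note ints = times_w[OF f wf] times_w[OF f wg] times_w[OF g wg] wf wg w
  let ?L = "\<lambda>\<phi>. LINT \<tau>:{0..x}|lebesgue. w \<tau> * \<phi> \<tau>"
  have "0 \<le> (LINT \<tau>:{0..x}|lebesgue. w \<tau> * (a * (f \<tau> * f \<tau>) + b * (f \<tau> * g \<tau>)
      + c * (g \<tau> * g \<tau>) + d * f \<tau> + e * g \<tau> + k))"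
    unfolding set_lebesgue_integral_def
    by (intro integral_nonneg_AE AE_I2) (auto simp: indicator_def w_def intro!: divide_nonneg_nonneg mult_nonneg_nonneg nonneg)
  also have "\<dots> = (LINT \<tau>:{0..x}|lebesgue. a * (w \<tau> * (f \<tau> * f \<tau>)) + b * (w \<tau> * (f \<tau> * g \<tau>))
      + c * (w \<tau> * (g \<tau> * g \<tau>)) + d * (w \<tau> * f \<tau>) + e * (w \<tau> * g \<tau>) + k * w \<tau>)"
    by (simp add: algebra_simps)
  also have "\<dots> = a * ?L (\<lambda>t. f t * f t) + b * ?L (\<lambda>t. f t * g t) + c * ?L (\<lambda>t. g t * g t)
      + d * ?L f + e * ?L g + k * ?L (\<lambda>_. 1)"
    using ints by (simp add: set_integral_add)
  finally have "0 \<le> C * \<dots>"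
    using pos by (intro mult_nonneg_nonneg) (auto simp: C_def intro!: divide_nonneg_pos Gamma_real_pos)
  also have "\<dots> = a * I (\<lambda>t. f t * f t) + b * I (\<lambda>t. f t * g t) + c * I (\<lambda>t. g t * g t)
      + d * I f + e * I g + k * I (\<lambda>_. 1)"
    by (simp add: I algebra_simps)
  also have "I (\<lambda>_. 1) = katugampola_Lambda \<rho> \<beta> x \<kappa> \<alpha> \<eta>"
    unfolding I_def by (rule katugampola_integral_one[OF pos])
  finally show ?thesis .
qed

text \<open>\<open>A0, A1, A2\<close> and \<open>B0, B1, B2\<close> model the moments of one
  function \<open>\<phi>\<close> under two weights. The conclusion is then the sign of the double
  integral of \<open>(\<phi> u - \<phi> v)\<^sup>2\<close> against their product.\<close>

lemma two_weight_variance_nonneg: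
  fixes A0 A1 A2 B0 B1 B2 :: real
  assumes "A0 \<ge> 0" "B0 > 0"
    and A: "\<And>c. 0 \<le> A2 - 2 * c * A1 + c\<^sup>2 * A0" and B: "\<And>c. 0 \<le> B2 - 2 * c * B1 + c\<^sup>2 * B0"
  shows "0 \<le> A0 * B2 + B0 * A2 - 2 * A1 * B1"
proof -
  \<comment> \<open>The mean under the second weight; testing the first weight against the same mean avoids a double integral.\<close>
  let ?c = "B1 / B0"
  have "0 \<le> B0 * (A2 - 2 * ?c * A1 + ?c\<^sup>2 * A0) + A0 * (B2 - 2 * ?c * B1 + ?c\<^sup>2 * B0)"
    by (rule add_nonneg_nonneg[OF mult_nonneg_nonneg[OF _ A] mult_nonneg_nonneg[OF _ B]])
      (use assms(1,2) in simp_all)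
  \<comment> \<open>The terms in \<open>A0 * B1\<^sup>2 / B0\<close> occur with coefficients 1, -2
    and 1, so they cancel.\<close>
  also have "\<dots> = A0 * B2 + B0 * A2 - 2 * A1 * B1"
    using \<open>B0 > 0\<close> by (simp add: field_simps power2_eq_square)
  finally show ?thesis .
qed

lemma binary_form_nonneg_discriminant:
  fixes a b c :: real
  assumes "\<And>s t. 0 \<le> s\<^sup>2 * a + 2 * s * t * b + t\<^sup>2 * c"
  shows "b\<^sup>2 \<le> a * c"
proof (cases "c = 0")
  case False
  have "0 \<le> c" using assms[of 0 1] by simp
  \<comment> \<open>The vector \<open>(c, - b)\<close> minimises the form in its second entry when
    the first is \<open>c\<close>.\<close>
  moreover have "0 \<le> c * (a * c - b\<^sup>2)"
    using assms[of c "- b"] by (simp add: power2_eq_square algebra_simps)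
  ultimately show ?thesis using False by (simp add: zero_le_mult_iff)
next
  case True
  have "b = 0"
  proof (rule ccontr)
    assume "b \<noteq> 0"
    \<comment> \<open>With \<open>c = 0\<close> and \<open>s = 1\<close> the form is affine in
      \<open>t\<close>; this \<open>t\<close> gives it the value -1.\<close>
    then show False
      using assms[of 1 "- (a + 1) / (2 * b)"] True by (simp add: field_simps)
  qed
  then show ?thesis using True by simp
qed

theorem theorem2:
  fixes f g :: "real \<Rightarrow> real" and m M p P \<alpha> \<beta> \<gamma> \<kappa> \<rho> \<eta> x :: real
  assumes "integrable_on_halfline f" and "integrable_on_halfline g"
    and "\<And>t. t \<ge> 0 \<Longrightarrow> m \<le> f t \<and> f t \<le> M"
    and "\<And>t. t \<ge> 0 \<Longrightarrow> p \<le> g t \<and> g t \<le> P"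
    and "x > 0" and "\<alpha> > 0" and "\<gamma> > 0" and "\<rho> > 0" and "\<eta> \<ge> 0"
  defines "\<Lambda>\<alpha> \<equiv> katugampola_Lambda \<rho> \<beta> x \<kappa> \<alpha> \<eta>"
    and "\<Lambda>\<gamma> \<equiv> katugampola_Lambda \<rho> \<beta> x \<kappa> \<gamma> \<eta>"
    and "I\<alpha> \<equiv> (\<lambda>\<phi>. katugampola_integral \<rho> \<eta> \<kappa> \<alpha> \<beta> \<phi> x)"
    and "I\<gamma> \<equiv> (\<lambda>\<phi>. katugampola_integral \<rho> \<eta> \<kappa> \<gamma> \<beta> \<phi> x)"
  shows "(\<Lambda>\<alpha> * I\<gamma> (\<lambda>t. f t * g t) + \<Lambda>\<gamma> * I\<alpha> (\<lambda>t. f t * g t) - I\<alpha> f * I\<gamma> g - I\<gamma> f * I\<alpha> g)\<^sup>2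
    \<le> ((M * \<Lambda>\<alpha> - I\<alpha> f) * (I\<gamma> f - m * \<Lambda>\<gamma>) + (I\<alpha> f - m * \<Lambda>\<alpha>) * (M * \<Lambda>\<gamma> - I\<gamma> f))
      * ((P * \<Lambda>\<alpha> - I\<alpha> g) * (I\<gamma> g - p * \<Lambda>\<gamma>) + (I\<alpha> g - p * \<Lambda>\<alpha>) * (P * \<Lambda>\<gamma> - I\<gamma> g))"
proof -
  have f: "f absolutely_integrable_on {0..x}" and g: "g absolutely_integrable_on {0..x}"
    using assms(1,2,5) by (auto simp: integrable_on_halfline_def)
  have "f ` {0..x} \<subseteq> {m..M}" "g ` {0..x} \<subseteq> {p..P}"
    using assms(3,4) by auto
  then have bf: "bounded (f ` {0..x})" and bg: "bounded (g ` {0..x})"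
    by (meson bounded_closed_interval bounded_subset)+
  have \<eta>: "\<eta> > -1" using \<open>\<eta> \<ge> 0\<close> by simp
  have I\<alpha>: "katugampola_integral \<rho> \<eta> \<kappa> \<alpha> \<beta> \<phi> x = I\<alpha> \<phi>"
    and I\<gamma>: "katugampola_integral \<rho> \<eta> \<kappa> \<gamma> \<beta> \<phi> x = I\<gamma> \<phi>" for \<phi>
    by (simp_all add: I\<alpha>_def I\<gamma>_def)
  note A = katugampola_integral_quadratic_nonneg
    [OF \<open>x > 0\<close> \<open>\<alpha> > 0\<close> \<open>\<rho> > 0\<close> \<eta> f bf g bg,
      where \<kappa> = \<kappa> and \<beta> = \<beta>, folded \<Lambda>\<alpha>_def, unfolded I\<alpha>]
  note B = katugampola_integral_quadratic_nonneg
    [OF \<open>x > 0\<close> \<open>\<gamma> > 0\<close> \<open>\<rho> > 0\<close> \<eta> f bf g bg,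
      where \<kappa> = \<kappa> and \<beta> = \<beta>, folded \<Lambda>\<gamma>_def, unfolded I\<gamma>]
  have pos: "\<Lambda>\<alpha> > 0" "\<Lambda>\<gamma> > 0"
    using katugampola_Lambda_pos assms \<eta> by (auto simp: \<Lambda>\<alpha>_def \<Lambda>\<gamma>_def)
  define H where "H = (\<lambda>\<phi> \<psi>. \<Lambda>\<alpha> * I\<gamma> (\<lambda>t. \<phi> t * \<psi> t) + \<Lambda>\<gamma> * I\<alpha> (\<lambda>t. \<phi> t * \<psi> t)
    - I\<alpha> \<phi> * I\<gamma> \<psi> - I\<gamma> \<phi> * I\<alpha> \<psi>)"
  have "0 \<le> s\<^sup>2 * H f f + 2 * s * t * H f g + t\<^sup>2 * H g g" for s t
  proof -
    have sq: "s\<^sup>2 * (f r * f r) + 2 * s * t * (f r * g r) + t\<^sup>2 * (g r * g r)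
        + - (2 * c * s) * f r + - (2 * c * t) * g r + c\<^sup>2 = (s * f r + t * g r - c)\<^sup>2" for c r
      by (simp add: power2_eq_square algebra_simps)
    \<comment> \<open>The zeroth, first and second moments here are those of
      \<open>s * f + t * g\<close> under the two operators, expanded by linearity; \<open>sq\<close>
      supplies the centred squares.\<close>
    have "0 \<le> \<Lambda>\<alpha> * (s\<^sup>2 * I\<gamma> (\<lambda>t. f t * f t) + 2 * s * t * I\<gamma> (\<lambda>t. f t * g t) + t\<^sup>2 * I\<gamma> (\<lambda>t. g t * g t))
      + \<Lambda>\<gamma> * (s\<^sup>2 * I\<alpha> (\<lambda>t. f t * f t) + 2 * s * t * I\<alpha> (\<lambda>t. f t * g t) + t\<^sup>2 * I\<alpha> (\<lambda>t. g t * g t))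
      - 2 * (s * I\<alpha> f + t * I\<alpha> g) * (s * I\<gamma> f + t * I\<gamma> g)"
    proof (rule two_weight_variance_nonneg)
      fix c
      show "0 \<le> s\<^sup>2 * I\<alpha> (\<lambda>t. f t * f t) + 2 * s * t * I\<alpha> (\<lambda>t. f t * g t) + t\<^sup>2 * I\<alpha> (\<lambda>t. g t * g t)
          - 2 * c * (s * I\<alpha> f + t * I\<alpha> g) + c\<^sup>2 * \<Lambda>\<alpha>"
        using A[of "s\<^sup>2" "2 * s * t" "t\<^sup>2" "- (2 * c * s)" "- (2 * c * t)" "c\<^sup>2"]
        unfolding sq by (simp add: algebra_simps)
      show "0 \<le> s\<^sup>2 * I\<gamma> (\<lambda>t. f t * f t) + 2 * s * t * I\<gamma> (\<lambda>t. f t * g t) + t\<^sup>2 * I\<gamma> (\<lambda>t. g t * g t)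
          - 2 * c * (s * I\<gamma> f + t * I\<gamma> g) + c\<^sup>2 * \<Lambda>\<gamma>"
        using B[of "s\<^sup>2" "2 * s * t" "t\<^sup>2" "- (2 * c * s)" "- (2 * c * t)" "c\<^sup>2"]
        unfolding sq by (simp add: algebra_simps)
    qed (use pos in auto)
    also have "\<dots> = s\<^sup>2 * H f f + 2 * s * t * H f g + t\<^sup>2 * H g g"
      by (simp add: H_def power2_eq_square algebra_simps)
    finally show ?thesis .
  qed
  note form = this
  have "(H f g)\<^sup>2 \<le> H f f * H g g"
    by (rule binary_form_nonneg_discriminant) (rule form)
  also have "\<dots> \<le> ((M * \<Lambda>\<alpha> - I\<alpha> f) * (I\<gamma> f - m * \<Lambda>\<gamma>) + (I\<alpha> f - m * \<Lambda>\<alpha>) * (M * \<Lambda>\<gamma> - I\<gamma> f))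
      * ((P * \<Lambda>\<alpha> - I\<alpha> g) * (I\<gamma> g - p * \<Lambda>\<gamma>) + (I\<alpha> g - p * \<Lambda>\<alpha>) * (P * \<Lambda>\<gamma> - I\<gamma> g))"
    (is "_ \<le> ?F * ?G")
  proof (rule mult_mono')
    \<comment> \<open>This is \<open>(M - f t) * (f t - m)\<close>, padded with zero coefficients to
      match \<open>A\<close> and \<open>B\<close>.\<close>
    have F: "0 \<le> - 1 * (f t * f t) + 0 * (f t * g t) + 0 * (g t * g t) + (M + m) * f t + 0 * g t + - (M * m)"
      if "t \<in> {0..x}" for t
    proof -
      have "0 \<le> (M - f t) * (f t - m)" using assms(3)[of t] that by simp
      then show ?thesis by (simp add: algebra_simps)
    qed
    have "0 \<le> \<Lambda>\<alpha> * (- 1 * I\<gamma> (\<lambda>t. f t * f t) + (M + m) * I\<gamma> f - M * m * \<Lambda>\<gamma>)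
      + \<Lambda>\<gamma> * (- 1 * I\<alpha> (\<lambda>t. f t * f t) + (M + m) * I\<alpha> f - M * m * \<Lambda>\<alpha>)"
      using A[OF F] B[OF F] pos by (intro add_nonneg_nonneg mult_nonneg_nonneg) auto
    \<comment> \<open>Both sides contain \<open>- 2 * I\<alpha> f * I\<gamma> f\<close>; what
      remains of \<open>?F - H f f\<close> is the expression just bounded below.\<close>
    then show "H f f \<le> ?F"
      by (simp add: H_def algebra_simps)
    have G: "0 \<le> 0 * (f t * f t) + 0 * (f t * g t) + - 1 * (g t * g t) + 0 * f t + (P + p) * g t + - (P * p)"
      if "t \<in> {0..x}" for t
    proof -
      have "0 \<le> (P - g t) * (g t - p)" using assms(4)[of t] that by simp
      then show ?thesis by (simp add: algebra_simps)
    qed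
    have "0 \<le> \<Lambda>\<alpha> * (- 1 * I\<gamma> (\<lambda>t. g t * g t) + (P + p) * I\<gamma> g - P * p * \<Lambda>\<gamma>)
      + \<Lambda>\<gamma> * (- 1 * I\<alpha> (\<lambda>t. g t * g t) + (P + p) * I\<alpha> g - P * p * \<Lambda>\<alpha>)"
      using A[OF G] B[OF G] pos by (intro add_nonneg_nonneg mult_nonneg_nonneg) auto
    then show "H g g \<le> ?G"
      by (simp add: H_def algebra_simps)
    \<comment> \<open>Multiplying the two bounds requires nonnegative smaller sides, which are the
      values of the form at the unit vectors.\<close>
    show "0 \<le> H f f" using form[of 1 0] by simp
    show "0 \<le> H g g" using form[of 0 1] by simp
  qed
  finally show ?thesis by (simp add: H_def)
qed

end
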